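(* Let $f_1,\dots,f_n:\mathbb{R}^m\to\mathbb{R}$ be convex, let $f=\sum_{i=1}^n f_i$, and assume that the set $X^*$ of minimizers of $f$ over $\mathbb{R}^m$ is nonempty, with optimal value $f^*=\min_{x\in\mathbb{R}^m} f(x)$. Let $A(k)=[a_{ij}(k)]_{i,j=1,\dots,n}$, $k\ge 0$, be a sequence of weight matrices satisfying the Weights Assumption (with constant $\eta>0$) and the Connectivity Assumption (with integer $B\ge 1$). Suppose there is a scalar $L$ such that $\|g\|\le L$ for all $i$, all $x\in\mathbb{R}^m$ and all $g\in\partial f_i(x)$. Let $\alpha>0$ and let $x_i(k)\in\mathbb{R}^m$, $i=1,\dots,n$, $k\ge 0$, satisfy $$x_i(k+1)=\sum_{j=1}^n a_{ij}(k)x_j(k)-\alpha d_i(k),\qquad d_i(k)\in\partial f_i(x_i(k)),$$ with initial vectors such that $\max_{1\le i\le n}\|x_i(0)\|\le \alpha L$. For $k\ge 1$ let $\hat x_i(k)=\frac1k\sum_{h=0}^{k-1}x_i(h)$. Then for all $i\in\{1,\dots,n\}$ and all $k\ge1$, $$f(\hat x_i(k))\le f^*+\frac{n\,\mathrm{dist}^2(y(0),X^* )}{2\alpha k}+\frac{\alpha L^2 C}{2}+2\alpha nL^2C_1,$$ where $$C=1+8nC_1,\qquad C_1=1+\frac{nB}{\beta(1-\beta)},\qquad \beta=1-\frac{\eta}{4n^2},\qquad y(0)=\frac1n\sum_{i=1}^n x_i(0).$$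
   Context: $\|\cdot\|$ is the Euclidean norm, $\mathrm{dist}(y,X^* )$ is the Euclidean distance from $y$ to the set $X^*$, and $\partial f_i(x)$ is the set of all subgradients of $f_i$ at $x$, where $s$ is a subgradient of a convex function $F$ at $\bar x$ if $F(\bar x)+s'(x-\bar x)\le F(x)$ for all $x$. Weights Assumption: for all $k\ge0$, the $n\times n$ matrix $A(k)$ is doubly stochastic (nonnegative entries, all row sums and all column sums equal to 1) with positive diagonal entries; additionally there is a scalar $\eta>0$ such that for all $i,j,k$, if $a_{ij}(k)>0$ then $a_{ij}(k)\ge\eta$. Connectivity Assumption: for a matrix $A$, let $\mathcal{E}(A)$ be the set of directed edges $(j,i)$ (including self-edges $(i,i)$) on $V=\{1,\dots,n\}$ such that $a_{ij}>0$. There is an integer $B\ge1$ such that for every $k\ge0$ the directed graph $\big(V,\ \mathcal{E}(A(kB))\cup\cdots\cup\mathcal{E}(A((k+1)B-1))\big)$ is strongly connected. *)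

theory Defs
  imports "Graph_Theory.Digraph_Component" "HOL-Analysis.Analysis"
begin

definition subdifferential :: "('a::real_inner \<Rightarrow> real) \<Rightarrow> 'a \<Rightarrow> 'a set" where
  "subdifferential F x = {s. \<forall>y. F x + s \<bullet> (y - x) \<le> F y}"

definition doubly_stochastic :: "real^'n^'n \<Rightarrow> bool" where
  "doubly_stochastic M \<longleftrightarrow>
     (\<forall>i j. 0 \<le> M $ i $ j) \<and>
     (\<forall>i. (\<Sum>j\<in>UNIV. M $ i $ j) = 1) \<and>
     (\<forall>j. (\<Sum>i\<in>UNIV. M $ i $ j) = 1)"

definition weights_assumption :: "(nat \<Rightarrow> real^'n^'n) \<Rightarrow> real \<Rightarrow> bool" where
  "weights_assumption A \<eta> \<longleftrightarrow>
     (\<forall>k. doubly_stochastic (A k) \<and> (\<forall>i. 0 < A k $ i $ i)) \<and>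
     0 < \<eta> \<and> (\<forall>i j k. 0 < A k $ i $ j \<longrightarrow> \<eta> \<le> A k $ i $ j)"

text \<open>Entry \<open>(i, j)\<close> is the weight agent \<open>i\<close> gives to agent \<open>j\<close>, so it induces
  the edge from \<open>j\<close> to \<open>i\<close>.\<close>

definition weight_edges :: "real^'n^'n \<Rightarrow> ('n \<times> 'n) set" where
  "weight_edges M = {(j, i). 0 < M $ i $ j}"

definition digraph_on_indices :: "('n \<times> 'n) set \<Rightarrow> ('n, 'n \<times> 'n) pre_digraph" where
  "digraph_on_indices E = \<lparr>verts = UNIV, arcs = E, tail = fst, head = snd\<rparr>"

definition connectivity_assumption :: "(nat \<Rightarrow> real^'n^'n) \<Rightarrow> nat \<Rightarrow> bool" where
  "connectivity_assumption A B \<longleftrightarrow>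
     1 \<le> B \<and>
     (\<forall>k. strongly_connected
            (digraph_on_indices (\<Union>t\<in>{k * B..<(k + 1) * B}. weight_edges (A t))))"

end

theory Submission
  imports Defs
begin

text \<open>
  The average \<open>y\<close> of all agents moves by \<open>y(k+1) = y(k) - \<alpha> g\<close>, where \<open>g\<close> is the
  average of the subgradients \<open>d\<^sub>i(k)\<close>, because doubly stochastic mixing preserves averages. This is a
  subgradient step for \<open>f / n\<close>, except that the subgradients are taken at the agents' points and not at
  \<open>y\<close>. As long as all agents stay within \<open>\<delta>\<close> of \<open>y\<close>, the classical telescoping argument
  with the squared distance from a minimizer bounds the suboptimality of the time averages, up to errors
  proportional to \<open>n L \<delta>\<close> (\<open>time_average_suboptimality\<close>). It compares values of every
  \<open>f\<^sub>i\<close> at points that are not iterates of agent \<open>i\<close>, so it uses that \<open>f\<^sub>i\<close> is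
  \<open>L\<close>-Lipschitz (\<open>subgradient_bound_imp_lipschitz\<close>).

  The remaining task is to bound \<open>\<delta>\<close>. The disagreement is the Euclidean norm of the matrix of deviations of the
  agents from their average. Over a window of \<open>B\<close> mixing steps without subgradients, it contracts by
  the factor \<open>\<beta> = 1 - \<eta> / (4 n\<^sup>2)\<close> (\<open>window_deviation_contraction\<close>). For one coordinate,
  sort the values at the start of the window and consider the gaps between
  consecutive values. By connectivity some edge crosses each gap during the window, and when this first happens the two
  sides are still at least the gap apart; mixing a weight of at least \<open>\<eta>\<close> across it
  removes \<open>\<eta> / 2\<close> times the squared gap from the sum of squared deviations. All the
  squared gaps together are at least \<open>1 / n\<^sup>2\<close> of that sum.

  The subgradient steps are perturbations of norm at most \<open>n \<alpha> L\<close>. Since mixing never increases disagreement and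
  the norm satisfies the triangle inequality, each window turns a disagreement \<open>D\<close> into at most
  \<open>\<beta> D + B n \<alpha> L\<close>, which sums to a geometric series (\<open>perturbed_consensus_deviation\<close>). This
  gives \<open>\<delta> = n \<alpha> L (1 + B / (1 - \<beta>) + B)\<close>, and the total error \<open>n \<alpha> L\<^sup>2 / 2 + 3 n L \<delta>\<close> fits
  into the stated constants (\<open>constant_comparison\<close>).
\<close>

section \<open>Subgradients of convex functions\<close>

text \<open>The strict epigraph is convex and misses the point \<open>(x, F x)\<close>. A separating
  hyperplane cannot be vertical, because \<open>F\<close> is finite on the whole space, and its
  slope is therefore a subgradient.\<close>
lemma subdifferential_nonempty:
  fixes F :: "'a::euclidean_space \<Rightarrow> real"
  assumes "convex_on UNIV F"
  shows "subdifferential F x \<noteq> {}"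
proof -
  let ?E = "{p. F (fst p) < snd p}"
  have "convex ?E"
  proof (rule convexI)
    fix p q :: "'a \<times> real" and u v :: real
    assume pq: "p \<in> ?E" "q \<in> ?E" and uv: "0 \<le> u" "0 \<le> v" "u + v = 1"
    have "F (u *\<^sub>R fst p + v *\<^sub>R fst q) \<le> u * F (fst p) + v * F (fst q)"
      using assms uv by (auto simp: convex_on_def)
    also have "\<dots> < u * snd p + v * snd q"
    proof (cases "u = 0")
      case True
      then show ?thesis using pq uv by simp
    next
      case False
      then have "u * F (fst p) < u * snd p" using pq uv by simp
      moreover have "v * F (fst q) \<le> v * snd q"
        using pq uv by (intro mult_left_mono) auto
      ultimately show ?thesis by linarith
    qed
    finally show "u *\<^sub>R p + v *\<^sub>R q \<in> ?E" by simp
  qed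
  moreover have "(x, F x + 1) \<in> ?E" by simp
  hence "?E \<noteq> {}" by blast
  ultimately obtain a b where a: "a \<noteq> 0" and low: "a \<bullet> (x, F x) \<le> b"
    and high: "\<And>p. p \<in> ?E \<Longrightarrow> b \<le> a \<bullet> p"
    using separating_hyperplane_sets[of "{(x, F x)}" ?E] by auto
  obtain v c where vc: "a = (v, c)" by (cases a)
  have sep: "v \<bullet> x + c * F x \<le> v \<bullet> y + c * (F y + e)" if "0 < e" for y e
    using low high[of "(y, F y + e)"] that by (simp add: vc)
  have c_nonneg: "0 \<le> c"
    using sep[of 1 x] by (simp add: algebra_simps)
  have "c \<noteq> 0"
  proof
    assume "c = 0"
    then have "v \<noteq> 0" using a vc by (simp add: zero_prod_def)
    then have "v \<bullet> v > 0" by simp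
    moreover have "v \<bullet> x \<le> v \<bullet> (x - v)"
      using sep[of 1 "x - v"] \<open>c = 0\<close> by simp
    ultimately show False unfolding inner_diff_right by linarith
  qed
  with c_nonneg have c: "0 < c" by simp
  have "F x + (- (1 / c) *\<^sub>R v) \<bullet> (y - x) \<le> F y" for y
  proof (rule field_le_epsilon)
    fix e :: real assume "0 < e"
    from sep[OF this, of y] c show "F x + (- (1 / c) *\<^sub>R v) \<bullet> (y - x) \<le> F y + e"
      by (simp add: field_simps inner_diff_right)
  qed
  then show ?thesis unfolding subdifferential_def by blast
qed

text \<open>The subgradient at \<open>x\<close> bounds the decrease from \<open>x\<close> to \<open>y\<close>. Its existence at an arbitrary
  point is essential: agents' objectives get compared at points that are not their own iterates.\<close>
lemma subgradient_bound_imp_lipschitz: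
  fixes F :: "'a::euclidean_space \<Rightarrow> real"
  assumes "convex_on UNIV F" and "\<And>z g. g \<in> subdifferential F z \<Longrightarrow> norm g \<le> L"
  shows "F x - F y \<le> L * norm (x - y)"
proof -
  obtain g where g: "g \<in> subdifferential F x"
    using subdifferential_nonempty[OF assms(1), of x] by blast
  then have "F x - F y \<le> g \<bullet> (x - y)"
    by (auto simp: subdifferential_def inner_diff_right algebra_simps dest!: spec[of _ y])
  also have "\<dots> \<le> norm g * norm (x - y)" by (rule norm_cauchy_schwarz)
  also have "\<dots> \<le> L * norm (x - y)" using assms(2)[OF g] by (intro mult_right_mono) auto
  finally show ?thesis .
qed

section \<open>Deviation from the average under doubly stochastic mixing\<close>

text \<open>The state of all agents is one vector indexed by the agents. Its entries may be real numbers
  or vectors: the contraction is proved for real entries and then applied to each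
  column of a matrix whose rows are the agents' vectors, with the Euclidean norm of
  \<open>deviation X\<close> as the measure of disagreement in both cases.\<close>
definition avg :: "'a::real_vector ^ 'n \<Rightarrow> 'a" where
  "avg X = (1 / real CARD('n)) *\<^sub>R (\<Sum>i\<in>UNIV. X $ i)"

definition deviation :: "'a::real_vector ^ 'n \<Rightarrow> 'a ^ 'n" where
  "deviation X = (\<chi> i. X $ i - avg X)"

lemma linear_avg: "linear avg"
  unfolding avg_def by (rule linearI) (simp_all add: sum.distrib scaleR_add_right scaleR_sum_right mult.commute)

lemma linear_deviation: "linear deviation"
  unfolding deviation_def
  by (rule linearI) (simp_all add: vec_eq_iff linear_add[OF linear_avg] linear_scale[OF linear_avg] algebra_simps)

lemma sum_eq_avg: "(\<Sum>i\<in>UNIV. X $ i) = real CARD('n) *\<^sub>R avg (X :: 'a::real_vector^'n)"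
  by (simp add: avg_def)

lemma norm_deviation_power2:
  fixes X :: "'a::real_inner^'n"
  shows "(norm (deviation X))\<^sup>2 = (\<Sum>i\<in>UNIV. (norm (X $ i))\<^sup>2) - real CARD('n) * (norm (avg X))\<^sup>2"
proof -
  have "(norm (deviation X))\<^sup>2 = (\<Sum>i\<in>UNIV. (norm (X $ i - avg X))\<^sup>2)"
    by (simp add: power2_norm_eq_inner inner_vec_def deviation_def)
  also have "\<dots> = (\<Sum>i\<in>UNIV. (norm (X $ i))\<^sup>2 - 2 * (X $ i \<bullet> avg X) + (norm (avg X))\<^sup>2)"
    by (intro sum.cong refl) (simp add: power2_norm_eq_inner algebra_simps inner_commute)
  also have "\<dots> = (\<Sum>i\<in>UNIV. (norm (X $ i))\<^sup>2) - 2 * ((\<Sum>i\<in>UNIV. X $ i) \<bullet> avg X)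
      + real CARD('n) * (norm (avg X))\<^sup>2"
    by (simp add: sum.distrib sum_subtractf sum_distrib_left inner_sum_left)
  finally show ?thesis
    by (simp add: sum_eq_avg power2_norm_eq_inner)
qed

lemma norm_deviation_le: "norm (deviation X) \<le> norm (X :: 'a::real_inner^'n)"
proof (rule power2_le_imp_le)
  have "(norm X)\<^sup>2 = (\<Sum>i\<in>UNIV. (norm (X $ i))\<^sup>2)"
    by (simp add: power2_norm_eq_inner inner_vec_def)
  then show "(norm (deviation X))\<^sup>2 \<le> (norm X)\<^sup>2"
    unfolding norm_deviation_power2 by simp
qed simp

lemma doubly_stochasticD:
  assumes "doubly_stochastic M"
  shows "0 \<le> M $ i $ j" and "(\<Sum>j\<in>UNIV. M $ i $ j) = 1" and "(\<Sum>i\<in>UNIV. M $ i $ j) = 1"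
  using assms by (auto simp: doubly_stochastic_def)

lemma avg_mult_vector:
  assumes "doubly_stochastic (M :: real^'n^'n)"
  shows "avg (M *v u) = avg u"
proof -
  have "(\<Sum>i\<in>UNIV. (M *v u) $ i) = (\<Sum>j\<in>UNIV. (\<Sum>i\<in>UNIV. M $ i $ j) * u $ j)"
    by (simp add: matrix_vector_mult_def sum_distrib_right, rule sum.swap)
  then show ?thesis using assms by (simp add: avg_def doubly_stochasticD)
qed

lemma column_mult: "column l (M ** X) = M *v column l (X :: real^'m^'n)"
  by (simp add: vec_eq_iff column_def matrix_matrix_mult_def matrix_vector_mult_def)

lemma avg_column: "avg (column l X) = avg (X :: real^'m^'n) $ l"
  by (simp add: avg_def column_def)

lemma avg_mult_matrix:
  assumes "doubly_stochastic (M :: real^'n^'n)"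
  shows "avg (M ** X) = avg (X :: real^'m^'n)"
  using avg_mult_vector[OF assms] by (simp add: vec_eq_iff flip: avg_column add: column_mult)

text \<open>Mixing acts on each coordinate of the agents' vectors separately, and so does this
  decomposition of the disagreement; this reduces contraction to real entries.\<close>
lemma norm_deviation_columns:
  "(norm (deviation (X :: real^'m^'n)))\<^sup>2 = (\<Sum>l\<in>UNIV. (norm (deviation (column l X)))\<^sup>2)"
proof -
  have "(\<Sum>l\<in>UNIV. (norm (deviation (column l X)))\<^sup>2) = (\<Sum>l\<in>UNIV. \<Sum>i\<in>UNIV. (X $ i $ l - avg X $ l)\<^sup>2)"
    by (simp add: power2_norm_eq_inner inner_vec_def deviation_def avg_column)
      (simp add: column_def power2_eq_square)
  also have "\<dots> = (\<Sum>i\<in>UNIV. \<Sum>l\<in>UNIV. (X $ i $ l - avg X $ l)\<^sup>2)"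
    by (rule sum.swap)
  finally show ?thesis
    unfolding power2_norm_eq_inner by (simp add: inner_vec_def deviation_def power2_eq_square)
qed

text \<open>The variance of a random variable is half the mean square difference of two
  independent copies.\<close>
lemma weighted_variance:
  fixes p v :: "'i \<Rightarrow> real"
  assumes "(\<Sum>i\<in>I. p i) = 1"
  shows "(\<Sum>i\<in>I. p i * (v i)\<^sup>2) - (\<Sum>i\<in>I. p i * v i)\<^sup>2
    = (\<Sum>i\<in>I. \<Sum>j\<in>I. p i * p j * (v i - v j)\<^sup>2) / 2"
proof -
  let ?q = "\<Sum>i\<in>I. p i * (v i)\<^sup>2" and ?m = "\<Sum>i\<in>I. p i * v i"
  have "(\<Sum>i\<in>I. \<Sum>j\<in>I. p i * p j * (v i - v j)\<^sup>2)
    = (\<Sum>i\<in>I. \<Sum>j\<in>I. (p i * (v i)\<^sup>2) * p j + p i * (p j * (v j)\<^sup>2) - 2 * ((p i * v i) * (p j * v j)))"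
    by (intro sum.cong refl) (simp add: power2_eq_square algebra_simps)
  also have "\<dots> = ?q * (\<Sum>i\<in>I. p i) + (\<Sum>i\<in>I. p i) * ?q - 2 * (?m * ?m)"
    by (simp only: sum.distrib sum_subtractf sum_product flip: sum_distrib_left)
  finally show ?thesis using assms by (simp add: power2_eq_square)
qed

text \<open>Each agent replaces its value by a weighted mean, which loses the variance of that weighted
  sample. Column sums equal to 1 make the total of the squares before averaging reappear.
  The right-hand side involves the weights \<open>M\<^sup>TM\<close>, and it is a sum of nonnegative terms.\<close>
lemma dispersion_drop:
  fixes u :: "real^'n"
  assumes "doubly_stochastic (M :: real^'n^'n)"
  shows "(norm (deviation u))\<^sup>2 - (norm (deviation (M *v u)))\<^sup>2
    = (\<Sum>k\<in>UNIV. \<Sum>i\<in>UNIV. \<Sum>j\<in>UNIV. M $ k $ i * M $ k $ j * (u $ i - u $ j)\<^sup>2) / 2"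
proof -
  have "(\<Sum>j\<in>UNIV. (u $ j)\<^sup>2) = (\<Sum>j\<in>UNIV. (\<Sum>k\<in>UNIV. M $ k $ j) * (u $ j)\<^sup>2)"
    using assms by (simp add: doubly_stochasticD)
  also have "\<dots> = (\<Sum>k\<in>UNIV. \<Sum>j\<in>UNIV. M $ k $ j * (u $ j)\<^sup>2)"
    unfolding sum_distrib_right by (rule sum.swap)
  finally have "(norm (deviation u))\<^sup>2 - (norm (deviation (M *v u)))\<^sup>2
    = (\<Sum>k\<in>UNIV. (\<Sum>j\<in>UNIV. M $ k $ j * (u $ j)\<^sup>2) - (\<Sum>j\<in>UNIV. M $ k $ j * u $ j)\<^sup>2)"
    unfolding norm_deviation_power2 avg_mult_vector[OF assms]
    by (simp add: sum_subtractf matrix_vector_mult_def)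
  also have "\<dots> = (\<Sum>k\<in>UNIV. (\<Sum>i\<in>UNIV. \<Sum>j\<in>UNIV. M $ k $ i * M $ k $ j * (u $ i - u $ j)\<^sup>2) / 2)"
    using assms by (intro sum.cong refl weighted_variance) (simp add: doubly_stochasticD)
  finally show ?thesis by (simp add: sum_divide_distrib)
qed

lemma norm_deviation_mult_le:
  assumes "doubly_stochastic (M :: real^'n^'n)"
  shows "norm (deviation (M ** X)) \<le> norm (deviation (X :: real^'m^'n))"
proof (rule power2_le_imp_le)
  have "(norm (deviation (M *v u)))\<^sup>2 \<le> (norm (deviation u))\<^sup>2" for u :: "real^'n"
  proof -
    have "0 \<le> (norm (deviation u))\<^sup>2 - (norm (deviation (M *v u)))\<^sup>2"
      unfolding dispersion_drop[OF assms] using assms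
      by (intro divide_nonneg_nonneg sum_nonneg mult_nonneg_nonneg) (simp_all add: doubly_stochasticD)
    then show ?thesis by simp
  qed
  then show "(norm (deviation (M ** X)))\<^sup>2 \<le> (norm (deviation X))\<^sup>2"
    unfolding norm_deviation_columns column_mult by (intro sum_mono)
qed simp

section \<open>Contraction of the deviation over a connected window\<close>

text \<open>Direction is irrelevant: by \<open>crossing_weight\<close> an edge either way mixes the two sides.\<close>
definition crosses :: "real^'n^'n \<Rightarrow> 'n set \<Rightarrow> bool" where
  "crosses M S \<longleftrightarrow> (\<exists>i j. M $ i $ j > 0 \<and> (i \<in> S \<longleftrightarrow> j \<notin> S))"

text \<open>For fixed \<open>k\<close> the double sum is \<open>c (1 - c)\<close>, where \<open>c\<close> is the weight that row \<open>k\<close> puts on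
  \<open>S\<close>. The receiving agent of a crossing edge has weight at least \<open>\<eta>\<close> on both sides, because of
  the edge itself and of its self-loop; so both factors are at least \<open>\<eta>\<close> there and one of them
  is at least 1/2.\<close>
lemma crossing_weight:
  fixes M :: "real^'n^'n"
  assumes ds: "doubly_stochastic M" and diag: "\<And>i. 0 < M $ i $ i"
    and \<eta>: "0 < \<eta>" "\<And>i j. 0 < M $ i $ j \<Longrightarrow> \<eta> \<le> M $ i $ j"
    and cr: "crosses M S"
  shows "\<eta> / 2 \<le> (\<Sum>k\<in>UNIV. \<Sum>i\<in>S. \<Sum>j\<in>-S. M $ k $ i * M $ k $ j)"
proof -
  define c where "c k = (\<Sum>i\<in>S. M $ k $ i)" for k
  have c': "(\<Sum>j\<in>-S. M $ k $ j) = 1 - c k" for k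
  proof -
    have "c k + (\<Sum>j\<in>-S. M $ k $ j) = (\<Sum>j\<in>S \<union> - S. M $ k $ j)"
      unfolding c_def by (intro sum.union_disjoint[symmetric]) auto
    then show ?thesis using doubly_stochasticD(2)[OF ds, of k] by simp
  qed
  have prod: "(\<Sum>i\<in>S. \<Sum>j\<in>-S. M $ k $ i * M $ k $ j) = c k * (1 - c k)" for k
    by (simp only: sum_product[symmetric] c' c_def[symmetric])
  have c_range: "0 \<le> c k" "c k \<le> 1" for k
    using sum_nonneg[of S "\<lambda>j. M $ k $ j"] sum_nonneg[of "-S" "\<lambda>j. M $ k $ j"] ds
    by (auto simp: c' c_def doubly_stochasticD)
  obtain k where k: "\<eta> \<le> c k" "\<eta> \<le> 1 - c k"
  proof -
    obtain i j where ij: "M $ i $ j > 0" "i \<in> S \<longleftrightarrow> j \<notin> S"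
      using cr by (auto simp: crosses_def)
    have mem: "\<eta> \<le> sum (\<lambda>j. M $ i $ j) T" if "l \<in> T" "M $ i $ l > 0" for l T
      using member_le_sum[of l T "\<lambda>j. M $ i $ j"] \<eta>(2)[OF that(2)] ds that
      by (simp add: doubly_stochasticD)
    show ?thesis
    proof (rule that[of i])
      show "\<eta> \<le> c i" unfolding c_def using ij diag[of i] mem by (cases "i \<in> S") auto
      show "\<eta> \<le> 1 - c i" unfolding c'[symmetric] using ij diag[of i] mem by (cases "i \<in> S") auto
    qed
  qed
  have "\<eta> / 2 \<le> c k * (1 - c k)"
  proof (cases "c k \<le> 1 / 2")
    case True
    then have "\<eta> * (1 / 2) \<le> c k * (1 - c k)" using k \<eta>(1) by (intro mult_mono) auto
    then show ?thesis by simp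
  next
    case False
    then have "(1 / 2) * \<eta> \<le> c k * (1 - c k)" using k \<eta>(1) by (intro mult_mono) auto
    then show ?thesis by simp
  qed
  also have "\<dots> \<le> (\<Sum>k\<in>UNIV. c k * (1 - c k))"
    using c_range by (intro member_le_sum) auto
  finally show ?thesis by (simp add: prod)
qed

text \<open>One difference that spans several gaps dominates the sum of their squares, so an edge
  that jumps over several cuts at once can be charged for each of them.\<close>
lemma sum_gaps_power2_le:
  fixes s :: "nat \<Rightarrow> real"
  assumes F: "F \<subseteq> {p<..q}" and "p \<le> q" and mono: "\<And>d. d \<in> {p<..q} \<Longrightarrow> s (d - 1) \<le> s d"
  shows "(\<Sum>d\<in>F. (s d - s (d - 1))\<^sup>2) \<le> (s q - s p)\<^sup>2"
proof (rule sqrt_le_D)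
  have "0 \<le> s d - s (d - 1)" if "d \<in> F" for d
    using mono that F by fastforce
  then have "sqrt (\<Sum>d\<in>F. (s d - s (d - 1))\<^sup>2) \<le> (\<Sum>d\<in>F. s d - s (d - 1))"
    using L2_set_le_sum[of F "\<lambda>d. s d - s (d - 1)"] unfolding L2_set_def by blast
  also have "\<dots> \<le> (\<Sum>d\<in>{p<..q}. s d - s (d - 1))"
    using F mono by (intro sum_mono2) auto
  also have "\<dots> = s q - s p"
    using sum_telescope''[OF \<open>p \<le> q\<close>, of s] unfolding atLeastSucAtMost_greaterThanAtMost[symmetric] by simp
  finally show "sqrt (\<Sum>d\<in>F. (s d - s (d - 1))\<^sup>2) \<le> s q - s p" .
qed

text \<open>Index \<open>i\<close> has rank \<open>r i\<close> when the entries of \<open>u\<close> are listed in increasing order as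
  \<open>s 0, s 1, \<dots>\<close>; ties are broken arbitrarily.\<close>
lemma sorted_ranks:
  fixes u :: "real^'n"
  obtains r :: "'n \<Rightarrow> nat" and s :: "nat \<Rightarrow> real"
  where "bij_betw r UNIV {..<CARD('n)}" and "\<And>i. u $ i = s (r i)"
    and "\<And>a b. a \<le> b \<Longrightarrow> b < CARD('n) \<Longrightarrow> s a \<le> s b"
proof -
  obtain ys :: "'n list" where ys: "set ys = UNIV" "distinct ys"
    using finite_distinct_list[of "UNIV :: 'n set"] by auto
  define xs where "xs = sort_key (\<lambda>i. u $ i) ys"
  have xs: "set xs = UNIV" "distinct xs" "sorted (map (\<lambda>i. u $ i) xs)"
    using ys by (simp_all add: xs_def)
  have len: "length xs = CARD('n)"
    using distinct_card[OF xs(2)] xs(1) by simp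
  have bij: "bij_betw (\<lambda>a. xs ! a) {..<CARD('n)} UNIV"
    using bij_betw_nth[OF xs(2), of "{..<CARD('n)}" UNIV] xs(1) len by simp
  show ?thesis
  proof (rule that)
    let ?r = "inv_into {..<CARD('n)} (\<lambda>a. xs ! a)"
    show "bij_betw ?r UNIV {..<CARD('n)}"
      using bij by (rule bij_betw_inv_into)
    show "u $ i = (\<lambda>a. u $ (xs ! a)) (?r i)" for i
      using bij_betw_inv_into_right[OF bij, of i] by simp
    show "(\<lambda>a. u $ (xs ! a)) a \<le> (\<lambda>a. u $ (xs ! a)) b" if "a \<le> b" "b < CARD('n)" for a b
      using sorted_nth_mono[OF xs(3) that(1)] that len by simp
  qed
qed

text \<open>The sides of a cut \<open>d\<close> in \<open>D\<close> are the agents of rank below \<open>d\<close> and those of rank at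
  least \<open>d\<close>. Their current values are still separated by the original gap between \<open>s (d - 1)\<close> and \<open>s d\<close>, and
  the step \<open>M\<close> mixes across it. In the formula of \<open>dispersion_drop\<close>, a pair of agents
  pays at least the squares of all gaps in \<open>D\<close> between them (\<open>sum_gaps_power2_le\<close>); exchanging the
  summations charges each gap with the total weight across its cut (\<open>crossing_weight\<close>).\<close>
lemma dispersion_drop_ge_crossed_gaps:
  fixes u :: "real^'n" and M :: "real^'n^'n" and r :: "'n \<Rightarrow> nat" and s :: "nat \<Rightarrow> real"
  assumes ds: "doubly_stochastic M" and diag: "\<And>i. 0 < M $ i $ i"
    and \<eta>: "0 < \<eta>" "\<And>i j. 0 < M $ i $ j \<Longrightarrow> \<eta> \<le> M $ i $ j"
    and mono: "\<And>a b. a \<le> b \<Longrightarrow> b < N \<Longrightarrow> s a \<le> s b"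
    and D: "D \<subseteq> {1..<N}"
    and cr: "\<And>d. d \<in> D \<Longrightarrow> crosses M {i. r i < d}"
    and low: "\<And>d i. d \<in> D \<Longrightarrow> r i < d \<Longrightarrow> u $ i \<le> s (d - 1)"
    and high: "\<And>d i. d \<in> D \<Longrightarrow> d \<le> r i \<Longrightarrow> s d \<le> u $ i"
  shows "\<eta> / 2 * (\<Sum>d\<in>D. (s d - s (d - 1))\<^sup>2) \<le> (norm (deviation u))\<^sup>2 - (norm (deviation (M *v u)))\<^sup>2"
proof -
  define g where "g d = (s d - s (d - 1))\<^sup>2" for d
  \<comment> \<open>The squared gaps in D that lie between i and j, zero unless i has the lower rank.\<close>
  define Q where "Q i j = (\<Sum>d\<in>{d\<in>D. r i < d \<and> d \<le> r j}. g d)" for i j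
  have finD: "finite D" using D finite_subset by blast
  have Q_le: "Q i j \<le> (u $ i - u $ j)\<^sup>2" for i j
  proof (cases "{d\<in>D. r i < d \<and> d \<le> r j} = {}")
    case True
    then show ?thesis by (simp add: Q_def del: Collect_empty_eq)
  next
    case False
    define F where "F = {d\<in>D. r i < d \<and> d \<le> r j}"
    have fF: "finite F" "F \<noteq> {}" using finD False by (auto simp: F_def)
    have mn: "Min F \<in> F" and mx: "Max F \<in> F" using fF by auto
    have mm: "Min F \<le> Max F" using fF by simp
    have b: "1 \<le> Min F" "Max F < N" using mn mx D by (auto simp: F_def)
    have "Q i j \<le> (s (Max F) - s (Min F - 1))\<^sup>2"
      unfolding Q_def g_def F_def[symmetric]
    proof (rule sum_gaps_power2_le)
      show "F \<subseteq> {Min F - 1<..Max F}" using fF b(1) by (fastforce dest: Min_le[OF fF(1)] Max_ge[OF fF(1)])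
      show "Min F - 1 \<le> Max F" using mm by simp
      show "s (d - 1) \<le> s d" if "d \<in> {Min F - 1<..Max F}" for d
        using that b by (intro mono) auto
    qed
    also have "\<dots> \<le> (u $ j - u $ i)\<^sup>2"
    proof (rule power_mono)
      show "s (Max F) - s (Min F - 1) \<le> u $ j - u $ i"
        using low[of "Min F" i] high[of "Max F" j] mn mx by (auto simp: F_def)
      show "0 \<le> s (Max F) - s (Min F - 1)"
        using mono[of "Min F - 1" "Max F"] mm b by auto
    qed
    finally show ?thesis by (simp add: power2_commute)
  qed
  have Q_sym: "Q i j + Q j i \<le> (u $ i - u $ j)\<^sup>2" for i j
  proof (cases "r i \<le> r j")
    case True
    then have "{d\<in>D. r j < d \<and> d \<le> r i} = {}" by auto
    then have "Q j i = 0" by (simp only: Q_def sum.empty)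
    then show ?thesis using Q_le[of i j] by simp
  next
    case False
    then have "{d\<in>D. r i < d \<and> d \<le> r j} = {}" by auto
    then have "Q i j = 0" by (simp only: Q_def sum.empty)
    then show ?thesis using Q_le[of j i] by (simp add: power2_commute)
  qed
  let ?m = "\<lambda>k i j. M $ k $ i * M $ k $ j"
  have m_nonneg: "0 \<le> ?m k i j" for k i j using ds by (simp add: doubly_stochasticD)
  have "\<eta> / 2 * (\<Sum>d\<in>D. g d) = (\<Sum>d\<in>D. \<eta> / 2 * g d)"
    by (rule sum_distrib_left)
  also have "\<dots> \<le> (\<Sum>d\<in>D. (\<Sum>k\<in>UNIV. \<Sum>i\<in>{i. r i < d}. \<Sum>j\<in>-{i. r i < d}. ?m k i j) * g d)"
    using crossing_weight[OF ds diag \<eta> cr] by (intro sum_mono mult_right_mono) (auto simp: g_def)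
  also have "\<dots> = (\<Sum>d\<in>D. \<Sum>k\<in>UNIV. \<Sum>i\<in>UNIV. \<Sum>j\<in>UNIV. if r i < d \<and> d \<le> r j then ?m k i j * g d else 0)"
  proof (intro sum.cong refl)
    fix d
    have "(\<Sum>i\<in>{i. r i < d}. \<Sum>j\<in>-{i. r i < d}. ?m k i j * g d)
      = (\<Sum>i\<in>UNIV. \<Sum>j\<in>UNIV. if r i < d \<and> d \<le> r j then ?m k i j * g d else 0)" for k
    proof -
      have "(\<Sum>i\<in>UNIV. \<Sum>j\<in>UNIV. if r i < d \<and> d \<le> r j then ?m k i j * g d else 0)
        = (\<Sum>i\<in>UNIV. if r i < d then \<Sum>j\<in>UNIV. if d \<le> r j then ?m k i j * g d else 0 else 0)"
        by (intro sum.cong refl) auto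
      also have "\<dots> = (\<Sum>i\<in>{i. r i < d}. \<Sum>j\<in>{j. d \<le> r j}. ?m k i j * g d)"
        by (simp add: sum.If_cases)
      also have "{j. d \<le> r j} = - {i. r i < d}" by auto
      finally show ?thesis by simp
    qed
    then show "(\<Sum>k\<in>UNIV. \<Sum>i\<in>{i. r i < d}. \<Sum>j\<in>-{i. r i < d}. ?m k i j) * g d
      = (\<Sum>k\<in>UNIV. \<Sum>i\<in>UNIV. \<Sum>j\<in>UNIV. if r i < d \<and> d \<le> r j then ?m k i j * g d else 0)"
      by (simp add: sum_distrib_right)
  qed
  also have "\<dots> = (\<Sum>k\<in>UNIV. \<Sum>i\<in>UNIV. \<Sum>j\<in>UNIV. \<Sum>d\<in>D. if r i < d \<and> d \<le> r j then ?m k i j * g d else 0)"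
    by (subst sum.swap, intro sum.cong refl, subst sum.swap, intro sum.cong refl, rule sum.swap)
  also have "\<dots> = (\<Sum>k\<in>UNIV. \<Sum>i\<in>UNIV. \<Sum>j\<in>UNIV. ?m k i j * Q i j)"
    using finD by (intro sum.cong refl) (simp add: Q_def sum_distrib_left sum.inter_filter if_distrib cong: if_cong)
  also have "\<dots> = (\<Sum>k\<in>UNIV. \<Sum>i\<in>UNIV. \<Sum>j\<in>UNIV. ?m k i j * (Q i j + Q j i)) / 2"
  proof -
    have "(\<Sum>i\<in>UNIV. \<Sum>j\<in>UNIV. ?m k i j * Q j i) = (\<Sum>i\<in>UNIV. \<Sum>j\<in>UNIV. ?m k i j * Q i j)" for k
      by (subst sum.swap) (simp add: mult.commute)
    then show ?thesis unfolding distrib_left sum.distrib by (simp only: mult_2[symmetric])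
  qed
  also have "\<dots> \<le> (\<Sum>k\<in>UNIV. \<Sum>i\<in>UNIV. \<Sum>j\<in>UNIV. ?m k i j * (u $ i - u $ j)\<^sup>2) / 2"
    using Q_sym m_nonneg by (intro divide_right_mono sum_mono mult_left_mono) auto
  also have "\<dots> = (norm (deviation u))\<^sup>2 - (norm (deviation (M *v u)))\<^sup>2"
    by (rule dispersion_drop[OF ds, symmetric])
  finally show ?thesis by (simp add: g_def)
qed

text \<open>Every entry lies within the range \<open>R\<close> of the smallest one, and centring at the average only
  decreases the norm; Cauchy-Schwarz bounds \<open>R\<^sup>2\<close> by the squares of the gaps that add up
  to \<open>R\<close>.\<close>
lemma dispersion_le_sum_gaps:
  fixes u :: "real^'n" and r :: "'n \<Rightarrow> nat" and s :: "nat \<Rightarrow> real"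
  assumes r: "\<And>i. r i < CARD('n)" and u: "\<And>i. u $ i = s (r i)"
    and mono: "\<And>a b. a \<le> b \<Longrightarrow> b < CARD('n) \<Longrightarrow> s a \<le> s b"
  shows "(norm (deviation u))\<^sup>2 \<le> (real CARD('n))\<^sup>2 * (\<Sum>d\<in>{1..<CARD('n)}. (s d - s (d - 1))\<^sup>2)"
proof -
  let ?n = "CARD('n)"
  let ?R = "s (?n - 1) - s 0" and ?G = "\<Sum>d\<in>{1..<?n}. (s d - s (d - 1))\<^sup>2"
  have n: "0 < ?n" by simp
  have tel: "(\<Sum>d\<in>{1..<Suc m}. s d - s (d - 1)) = s m - s 0" for m
    by (induction m) auto
  have "deviation u = deviation (u - (\<chi> i. s 0))"
  proof -
    have "deviation (\<chi> i::'n. s 0) = 0"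
      by (simp add: deviation_def avg_def vec_eq_iff)
    then show ?thesis by (simp add: linear_diff[OF linear_deviation])
  qed
  then have "(norm (deviation u))\<^sup>2 \<le> (norm (u - (\<chi> i. s 0)))\<^sup>2"
    by (simp add: norm_deviation_le power_mono)
  also have "\<dots> = (\<Sum>i\<in>UNIV. (s (r i) - s 0)\<^sup>2)"
    unfolding power2_norm_eq_inner by (simp add: inner_vec_def u power2_eq_square)
  also have "\<dots> \<le> (\<Sum>i\<in>(UNIV :: 'n set). ?R\<^sup>2)"
  proof (intro sum_mono power_mono)
    fix i
    have "r i \<le> ?n - 1" using r[of i] by linarith
    then show "s (r i) - s 0 \<le> ?R" using mono[of "r i" "?n - 1"] n by simp
    show "0 \<le> s (r i) - s 0" using mono[of 0 "r i"] r[of i] by simp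
  qed
  also have "\<dots> = real ?n * ?R\<^sup>2" by simp
  also have "?R\<^sup>2 \<le> real ?n * ?G"
  proof -
    have "?R = (\<Sum>d\<in>{1..<?n}. s d - s (d - 1))" using tel[of "?n - 1"] n by simp
    then have "?R\<^sup>2 = (\<Sum>d\<in>{1..<?n}. 1 * (s d - s (d - 1)))\<^sup>2" by simp
    also have "\<dots> \<le> (\<Sum>d\<in>{1..<?n}. 1\<^sup>2) * ?G" by (rule Cauchy_Schwarz_ineq_sum)
    also have "\<dots> \<le> real ?n * ?G" by (intro mult_right_mono sum_nonneg) auto
    finally show ?thesis .
  qed
  finally show ?thesis by (simp add: power2_eq_square mult_left_mono mult.assoc)
qed

text \<open>Sort the initial values. Until the first time a cut is crossed, averaging takes place within each of its
  sides, so the values on the two sides stay separated by the original gap. At that first time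
  the dispersion, the squared norm of the deviation, loses at least \<open>\<eta> / 2\<close> times the squared gap. Every cut is crossed
  during the window, each gap is charged at exactly one time, and together the squared gaps make up at
  least \<open>1 / n\<^sup>2\<close> of the initial dispersion.\<close>
lemma window_dispersion_contraction:
  fixes z :: "nat \<Rightarrow> real^'n" and M :: "nat \<Rightarrow> real^'n^'n"
  assumes ds: "\<And>t. doubly_stochastic (M t)" and diag: "\<And>t i. 0 < M t $ i $ i"
    and \<eta>: "0 < \<eta>" "\<And>t i j. 0 < M t $ i $ j \<Longrightarrow> \<eta> \<le> M t $ i $ j"
    and step: "\<And>t. z (Suc t) = M t *v z t"
    and cross: "\<And>S. S \<noteq> {} \<Longrightarrow> S \<noteq> UNIV \<Longrightarrow> \<exists>t<B. crosses (M t) S"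
  shows "(norm (deviation (z B)))\<^sup>2 \<le> (1 - \<eta> / (2 * (real CARD('n))\<^sup>2)) * (norm (deviation (z 0)))\<^sup>2"
proof -
  let ?n = "CARD('n)"
  obtain r :: "'n \<Rightarrow> nat" and s where r: "bij_betw r UNIV {..<?n}" and u: "\<And>i. z 0 $ i = s (r i)"
    and mono: "\<And>a b. a \<le> b \<Longrightarrow> b < ?n \<Longrightarrow> s a \<le> s b"
    using sorted_ranks[of "z 0"] by metis
  have r_less: "r i < ?n" for i using r by (auto simp: bij_betw_def)
  define first where "first d = (LEAST t. crosses (M t) {i. r i < d})" for d
  have first: "first d < B" "crosses (M (first d)) {i. r i < d}" if "d \<in> {1..<?n}" for d
  proof -
    have "0 \<in> range r" "d \<in> range r" using r that by (auto simp: bij_betw_def)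
    then obtain i j where "r i = 0" "r j = d" by (metis imageE)
    then have "i \<in> {i. r i < d}" "j \<notin> {i. r i < d}" using that by auto
    then have "{i. r i < d} \<noteq> {}" "{i. r i < d} \<noteq> UNIV" by blast+
    from cross[OF this] obtain t where "t < B" "crosses (M t) {i. r i < d}" by (elim exE conjE)
    moreover from this have "first d \<le> t" unfolding first_def by (intro Least_le)
    ultimately show "first d < B" by simp
    show "crosses (M (first d)) {i. r i < d}"
      unfolding first_def by (rule LeastI) fact
  qed
  have sides: "(r i < d \<longrightarrow> z t $ i \<le> s (d - 1)) \<and> (d \<le> r i \<longrightarrow> s d \<le> z t $ i)"
    if d: "d \<in> {1..<?n}" and "t \<le> first d" for d t i
    using \<open>t \<le> first d\<close>
  proof (induction t arbitrary: i)
    case 0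
    have "s (r i) \<le> s (d - 1)" if "r i < d" using that d by (intro mono) auto
    moreover have "s d \<le> s (r i)" if "d \<le> r i" using that r_less by (intro mono)
    ultimately show ?case by (simp add: u)
  next
    case (Suc t)
    have IH: "r j < d \<Longrightarrow> z t $ j \<le> s (d - 1)" "d \<le> r j \<Longrightarrow> s d \<le> z t $ j" for j
      using Suc by auto
    \<comment> \<open>Before the first crossing no agent listens to the other side.\<close>
    have "\<not> crosses (M t) {i. r i < d}"
      using Suc.prems not_less_Least[of t "\<lambda>t. crosses (M t) {i. r i < d}"] by (simp add: first_def)
    then have zero: "M t $ i $ j = 0" if "(r i < d) \<noteq> (r j < d)" for i j
      using that doubly_stochasticD(1)[OF ds, of t i j] by (auto simp: crosses_def less_le)
    have rows: "(\<Sum>j\<in>UNIV. M t $ i $ j * c) = c" for c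
      using doubly_stochasticD(2)[OF ds, of t i] by (simp flip: sum_distrib_right)
    have "z (Suc t) $ i = (\<Sum>j\<in>UNIV. M t $ i $ j * z t $ j)"
      by (simp add: step matrix_vector_mult_def)
    moreover have "\<dots> \<le> (\<Sum>j\<in>UNIV. M t $ i $ j * s (d - 1))" if "r i < d"
    proof (rule sum_mono)
      fix j show "M t $ i $ j * z t $ j \<le> M t $ i $ j * s (d - 1)"
        using zero[of i j] IH(1)[of j] that doubly_stochasticD(1)[OF ds, of t i j]
        by (cases "r j < d") (auto intro: mult_left_mono)
    qed
    moreover have "(\<Sum>j\<in>UNIV. M t $ i $ j * s d) \<le> (\<Sum>j\<in>UNIV. M t $ i $ j * z t $ j)" if "d \<le> r i"
    proof (rule sum_mono)
      fix j show "M t $ i $ j * s d \<le> M t $ i $ j * z t $ j"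
        using zero[of i j] IH(2)[of j] that doubly_stochasticD(1)[OF ds, of t i j]
        by (cases "r j < d") (auto intro: mult_left_mono)
    qed
    ultimately show ?case by (simp add: rows)
  qed
  let ?V = "\<lambda>t. (norm (deviation (z t)))\<^sup>2"
  let ?g = "\<lambda>d. (s d - s (d - 1))\<^sup>2"
  have drop: "\<eta> / 2 * (\<Sum>d\<in>{d\<in>{1..<?n}. first d = t}. ?g d) \<le> ?V t - ?V (Suc t)" for t
    unfolding step
  proof (rule dispersion_drop_ge_crossed_gaps[where N = "?n" and r = r])
    fix d assume d: "d \<in> {d\<in>{1..<?n}. first d = t}"
    show "crosses (M t) {i. r i < d}" using d first(2)[of d] by blast
    show "z t $ i \<le> s (d - 1)" if "r i < d" for i using d that sides[of d t i] by simp
    show "s d \<le> z t $ i" if "d \<le> r i" for i using d that sides[of d t i] by simp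
  next
    show "doubly_stochastic (M t)" and "0 < M t $ i $ i" for i by (fact ds, fact diag)
    show "0 < \<eta>" by fact
    show "\<eta> \<le> M t $ i $ j" if "0 < M t $ i $ j" for i j using that by (fact \<eta>(2))
    show "s a \<le> s b" if "a \<le> b" "b < ?n" for a b using that by (fact mono)
  qed blast
  \<comment> \<open>The cuts are partitioned by their first crossing times.\<close>
  have "\<eta> / 2 * (\<Sum>d\<in>{1..<?n}. ?g d) = \<eta> / 2 * (\<Sum>t\<in>{..<B}. \<Sum>d\<in>{d\<in>{1..<?n}. first d = t}. ?g d)"
    using first(1) by (subst sum.group) auto
  also have "\<dots> \<le> (\<Sum>t<B. ?V t - ?V (Suc t))"
    by (subst sum_distrib_left) (intro sum_mono drop)
  also have "\<dots> = ?V 0 - ?V B"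
    by (rule sum_lessThan_telescope')
  finally have "?V B \<le> ?V 0 - \<eta> / 2 * (\<Sum>d\<in>{1..<?n}. ?g d)" by simp
  also have "\<dots> \<le> ?V 0 - \<eta> / 2 * (?V 0 / (real ?n)\<^sup>2)"
    using dispersion_le_sum_gaps[of r "z 0" s, OF r_less u mono] \<eta>(1)
    by (intro diff_left_mono mult_left_mono) (simp_all add: field_simps)
  also have "\<dots> = (1 - \<eta> / (2 * (real ?n)\<^sup>2)) * ?V 0"
    by (simp add: algebra_simps)
  finally show ?thesis .
qed

text \<open>A path from a vertex in \<open>S\<close> to one outside must use an edge that leaves \<open>S\<close>.\<close>
lemma connected_window_crosses:
  fixes A :: "nat \<Rightarrow> real^'n^'n"
  assumes conn: "connectivity_assumption A B" and S: "S \<noteq> {}" "S \<noteq> UNIV"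
  shows "\<exists>t<B. crosses (A (q * B + t)) S"
proof -
  let ?E = "\<Union>t\<in>{q * B..<(q + 1) * B}. weight_edges (A t)"
  obtain u v where uv: "u \<in> S" "v \<notin> S" using S by blast
  have "strongly_connected (digraph_on_indices ?E)"
    using conn by (simp add: connectivity_assumption_def)
  then have "(u, v) \<in> rtrancl_on UNIV (arcs_ends (digraph_on_indices ?E))"
    by (simp add: strongly_connected_def reachable_def digraph_on_indices_def)
  moreover have "arcs_ends (digraph_on_indices ?E) = ?E"
    by (simp add: arcs_ends_def arc_to_ends_def digraph_on_indices_def)
  ultimately have "(u, v) \<in> rtrancl_on UNIV ?E" by simp
  then have "v \<in> S \<or> (\<exists>a b. (a, b) \<in> ?E \<and> a \<in> S \<and> b \<notin> S)"
    using uv(1) by (induction rule: rtrancl_on.induct) blast+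
  then obtain a b t where "q * B \<le> t" "t < (q + 1) * B" "(a, b) \<in> weight_edges (A t)" "a \<in> S" "b \<notin> S"
    using uv(2) by auto
  then have "t - q * B < B" "crosses (A (q * B + (t - q * B))) S"
    by (auto simp: crosses_def weight_edges_def)
  then show ?thesis by blast
qed

lemma weight_floor_le_1:
  assumes "weights_assumption (A :: nat \<Rightarrow> real^'n^'n) \<eta>"
  shows "\<eta> \<le> 1"
proof -
  have ds: "doubly_stochastic (A 0)" and "0 < A 0 $ i $ i" for i
    using assms by (auto simp: weights_assumption_def)
  then have "\<eta> \<le> A 0 $ i $ i" for i using assms by (auto simp: weights_assumption_def)
  also have "A 0 $ i $ i \<le> (\<Sum>j\<in>UNIV. A 0 $ i $ j)" for i
    using ds by (intro member_le_sum) (auto simp: doubly_stochasticD)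
  finally show ?thesis using doubly_stochasticD(2)[OF ds] by simp
qed

text \<open>A diagonal weight is at least \<open>\<eta>\<close> and at most 1. The contraction argument uses
  that the factor is not negative; the sharper value 3/4 serves \<open>constant_comparison\<close>.\<close>
lemma contraction_factor_ge:
  assumes "weights_assumption (A :: nat \<Rightarrow> real^'n^'n) \<eta>"
  shows "3 / 4 \<le> 1 - \<eta> / (4 * (real CARD('n))\<^sup>2)"
proof -
  have "1 \<le> (real CARD('n))\<^sup>2" by (simp add: Suc_le_eq)
  then have "\<eta> \<le> (real CARD('n))\<^sup>2" using weight_floor_le_1[OF assms] by linarith
  then show ?thesis by (simp add: field_simps)
qed

text \<open>For norms instead of squares the rate halves, as \<open>1 - 2 c \<le> (1 - c)\<^sup>2\<close>.\<close>
lemma window_deviation_contraction: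
  fixes Z :: "nat \<Rightarrow> real^'m^'n" and A :: "nat \<Rightarrow> real^'n^'n"
  assumes weights: "weights_assumption A \<eta>" and conn: "connectivity_assumption A B"
    and step: "\<And>t. Z (Suc t) = A (q * B + t) ** Z t"
  shows "norm (deviation (Z B)) \<le> (1 - \<eta> / (4 * (real CARD('n))\<^sup>2)) * norm (deviation (Z 0))"
proof (rule power2_le_imp_le)
  let ?c = "\<eta> / (4 * (real CARD('n))\<^sup>2)"
  have col: "(norm (deviation (column l (Z B))))\<^sup>2
      \<le> (1 - \<eta> / (2 * (real CARD('n))\<^sup>2)) * (norm (deviation (column l (Z 0))))\<^sup>2" for l
  proof (rule window_dispersion_contraction[where M = "\<lambda>t. A (q * B + t)"])
    show "\<exists>t<B. crosses (A (q * B + t)) S" if "S \<noteq> {}" "S \<noteq> UNIV" for S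
      by (rule connected_window_crosses[OF conn that])
  qed (use weights in \<open>auto simp: weights_assumption_def step column_mult\<close>)
  have "(norm (deviation (Z B)))\<^sup>2 \<le> (1 - 2 * ?c) * (norm (deviation (Z 0)))\<^sup>2"
    unfolding norm_deviation_columns sum_distrib_left using col by (intro sum_mono) simp
  also have "\<dots> \<le> (1 - ?c)\<^sup>2 * (norm (deviation (Z 0)))\<^sup>2"
    by (intro mult_right_mono) (simp_all add: power2_diff)
  finally show "(norm (deviation (Z B)))\<^sup>2 \<le> ((1 - ?c) * norm (deviation (Z 0)))\<^sup>2"
    by (simp add: power_mult_distrib)
  have "0 \<le> 1 - ?c" using contraction_factor_ge[OF weights] by linarith
  then show "0 \<le> (1 - ?c) * norm (deviation (Z 0))" by simp
qed

section \<open>Consensus in spite of bounded perturbations\<close>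

text \<open>Compare each window with the unperturbed evolution from the same starting state: the latter
  contracts by \<open>\<beta>\<close>, and the difference grows by at most \<open>e\<close> per step since mixing does not
  increase the deviation. Thus one window maps a bound \<open>D\<close> to \<open>\<beta> D + B e\<close>. The last term
  accounts for the steps after the last complete window.\<close>
lemma perturbed_consensus_deviation:
  fixes Y E :: "nat \<Rightarrow> real^'m^'n" and A :: "nat \<Rightarrow> real^'n^'n"
  assumes weights: "weights_assumption A \<eta>" and conn: "connectivity_assumption A B"
    and step: "\<And>k. Y (Suc k) = A k ** Y k - E k" and E: "\<And>k. norm (E k) \<le> e"
    and \<beta>: "\<beta> = 1 - \<eta> / (4 * (real CARD('n))\<^sup>2)"
  shows "norm (deviation (Y k)) \<le> norm (deviation (Y 0)) + real B * e / (1 - \<beta>) + real B * e"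
proof -
  let ?D = "\<lambda>X :: real^'m^'n. norm (deviation X)"
  have ds: "doubly_stochastic (A k)" for k using weights by (simp add: weights_assumption_def)
  have e: "0 \<le> e" using E[of 0] norm_ge_zero order_trans by blast
  have B: "1 \<le> B" using conn by (simp add: connectivity_assumption_def)
  have \<beta>1: "0 < 1 - \<beta>" using weights by (simp add: \<beta> weights_assumption_def)
  have triangle: "?D (U - V) \<le> ?D U + ?D V" for U V
    by (simp add: linear_diff[OF linear_deviation] norm_triangle_ineq4)
  have drift: "?D (Y (k + t)) \<le> ?D (Y k) + real t * e" for k t
  proof (induction t)
    case (Suc t)
    have "?D (Y (k + Suc t)) \<le> ?D (A (k + t) ** Y (k + t)) + ?D (E (k + t))"
      by (simp add: step triangle)
    also have "\<dots> \<le> ?D (Y (k + t)) + e"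
      using norm_deviation_mult_le[OF ds] norm_deviation_le E by (intro add_mono) (blast intro: order_trans)+
    finally show ?case using Suc by (simp add: algebra_simps)
  qed simp
  have window: "?D (Y (Suc q * B)) \<le> \<beta> * ?D (Y (q * B)) + real B * e" for q
  proof -
    \<comment> \<open>The unperturbed evolution through this window.\<close>
    define Z where "Z = rec_nat (Y (q * B)) (\<lambda>t X. A (q * B + t) ** X)"
    have Z: "Z 0 = Y (q * B)" "Z (Suc t) = A (q * B + t) ** Z t" for t by (simp_all add: Z_def)
    have "?D (Y (q * B + t) - Z t) \<le> real t * e" for t
    proof (induction t)
      case 0
      then show ?case by (simp add: Z linear_0[OF linear_deviation])
    next
      case (Suc t)
      let ?M = "A (q * B + t)"
      have "Y (q * B + Suc t) - Z (Suc t) = ?M ** (Y (q * B + t) - Z t) - E (q * B + t)"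
        by (simp add: step Z matrix_matrix_mult_def vec_eq_iff sum_subtractf right_diff_distrib)
      then have "?D (Y (q * B + Suc t) - Z (Suc t)) \<le> ?D (?M ** (Y (q * B + t) - Z t)) + ?D (E (q * B + t))"
        using triangle by simp
      also have "\<dots> \<le> ?D (Y (q * B + t) - Z t) + e"
        using norm_deviation_mult_le[OF ds] norm_deviation_le E by (intro add_mono) (blast intro: order_trans)+
      finally show ?case using Suc by (simp add: algebra_simps)
    qed
    then have diff: "?D (Y (q * B + B) - Z B) \<le> real B * e" .
    have "?D (Y (Suc q * B)) = norm (deviation (Z B) + deviation (Y (q * B + B) - Z B))"
      by (simp add: linear_diff[OF linear_deviation] add.commute)
    also have "\<dots> \<le> ?D (Z B) + ?D (Y (q * B + B) - Z B)" by (rule norm_triangle_ineq)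
    also have "\<dots> \<le> \<beta> * ?D (Z 0) + real B * e"
      using window_deviation_contraction[where Z = Z and q = q, OF weights conn Z(2)] diff by (simp add: \<beta>)
    finally show ?thesis by (simp add: Z)
  qed
  have \<beta>0: "0 \<le> \<beta>" using contraction_factor_ge[OF weights] by (simp only: \<beta>)
  have multiples: "?D (Y (q * B)) \<le> ?D (Y 0) + real B * e / (1 - \<beta>)" for q
  proof (induction q)
    case 0
    then show ?case using e \<beta>1 by simp
  next
    case (Suc q)
    have "\<beta> * ?D (Y (q * B)) \<le> \<beta> * (?D (Y 0) + real B * e / (1 - \<beta>))"
      using Suc \<beta>0 by (rule mult_left_mono)
    also have "\<dots> \<le> ?D (Y 0) + \<beta> * (real B * e / (1 - \<beta>))"
      using mult_right_mono[of \<beta> 1 "?D (Y 0)"] \<beta>1 by (simp add: distrib_left)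
    also have "\<beta> * (real B * e / (1 - \<beta>)) = real B * e / (1 - \<beta>) - real B * e"
      using \<beta>1 by (simp add: field_simps)
    finally show ?case using window[of q] by simp
  qed
  have "?D (Y k) = ?D (Y (k div B * B + k mod B))" by simp
  also have "\<dots> \<le> ?D (Y (k div B * B)) + real (k mod B) * e" by (rule drift)
  also have "real (k mod B) * e \<le> real B * e" using B e by (intro mult_right_mono) (auto simp: less_imp_le)
  finally show ?thesis using multiples[of "k div B"] by simp
qed

section \<open>The average of the agents as an approximate subgradient method\<close>

text \<open>The usual estimate for a subgradient step, except that the direction is the average of subgradients
  taken at the points \<open>X $ i\<close> rather than at \<open>avg X\<close>. Moving the inner product
  from one point to the other, and comparing the values of \<open>fi i\<close> at them, costs
  \<open>L * \<delta>\<close> each per agent.\<close>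
lemma averaged_subgradient_step:
  fixes X G :: "'a::euclidean_space ^ 'n" and fi :: "'n \<Rightarrow> 'a \<Rightarrow> real"
  assumes G: "\<And>i. G $ i \<in> subdifferential (fi i) (X $ i)" and L: "\<And>i. norm (G $ i) \<le> L"
    and lip: "\<And>i a b. fi i a - fi i b \<le> L * norm (a - b)"
    and \<alpha>: "0 < \<alpha>" and \<delta>: "\<And>i. norm (X $ i - avg X) \<le> \<delta>"
  shows "(\<Sum>i\<in>UNIV. fi i (avg X)) - (\<Sum>i\<in>UNIV. fi i z)
    \<le> real CARD('n) / (2 * \<alpha>) * ((norm (avg X - z))\<^sup>2 - (norm (avg X - \<alpha> *\<^sub>R avg G - z))\<^sup>2)
      + real CARD('n) * \<alpha> * L\<^sup>2 / 2 + 2 * real CARD('n) * L * \<delta>"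
proof -
  let ?n = "real CARD('n)" and ?y = "avg X" and ?g = "avg G"
  have L0: "0 \<le> L" using L order_trans[OF norm_ge_zero] by blast
  have each: "fi i ?y - fi i z - 2 * (L * \<delta>) \<le> G $ i \<bullet> (?y - z)" for i
  proof -
    have L\<delta>: "L * norm (X $ i - ?y) \<le> L * \<delta>" using \<delta>[of i] L0 by (intro mult_left_mono)
    have "fi i (X $ i) + G $ i \<bullet> (z - X $ i) \<le> fi i z"
      using G[of i] by (simp add: subdifferential_def)
    moreover have "fi i ?y - fi i (X $ i) \<le> L * norm (X $ i - ?y)"
      using lip[of i ?y "X $ i"] by (simp add: norm_minus_commute)
    moreover have "G $ i \<bullet> (X $ i - ?y) \<le> L * norm (X $ i - ?y)"
      by (rule order_trans[OF norm_cauchy_schwarz]) (intro mult_right_mono L, simp)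
    ultimately show ?thesis using L\<delta> by (simp add: inner_diff_right)
  qed
  have "(\<Sum>i\<in>UNIV. fi i ?y) - (\<Sum>i\<in>UNIV. fi i z) - 2 * ?n * L * \<delta>
    = (\<Sum>i\<in>(UNIV :: 'n set). fi i ?y - fi i z - 2 * (L * \<delta>))"
    by (simp add: sum_subtractf)
  also have "\<dots> \<le> (\<Sum>i\<in>UNIV. G $ i \<bullet> (?y - z))" by (intro sum_mono each)
  also have "\<dots> = ?n * (?g \<bullet> (?y - z))"
    by (simp add: sum_eq_avg flip: inner_sum_left)
  finally have grad: "(\<Sum>i\<in>UNIV. fi i ?y) - (\<Sum>i\<in>UNIV. fi i z) - 2 * ?n * L * \<delta> \<le> ?n * (?g \<bullet> (?y - z))" .
  have g: "norm ?g \<le> L"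
  proof -
    have "norm (\<Sum>i\<in>UNIV. G $ i) \<le> ?n * L" using sum_norm_bound[of UNIV "\<lambda>i. G $ i" L] L by simp
    then show ?thesis by (simp add: avg_def field_simps)
  qed
  have "(norm (?y - \<alpha> *\<^sub>R ?g - z))\<^sup>2
    = (norm (?y - z))\<^sup>2 - 2 * \<alpha> * (?g \<bullet> (?y - z)) + \<alpha>\<^sup>2 * (norm ?g)\<^sup>2"
    unfolding power2_norm_eq_inner
    by (simp add: inner_diff_left inner_diff_right inner_commute algebra_simps power2_eq_square)
  also have "\<dots> \<le> (norm (?y - z))\<^sup>2 - 2 * \<alpha> * (?g \<bullet> (?y - z)) + \<alpha>\<^sup>2 * L\<^sup>2"
    using g by (simp add: mult_left_mono power_mono)
  finally have "?n / (2 * \<alpha>) * (2 * \<alpha> * (?g \<bullet> (?y - z)))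
    \<le> ?n / (2 * \<alpha>) * ((norm (?y - z))\<^sup>2 - (norm (?y - \<alpha> *\<^sub>R ?g - z))\<^sup>2 + \<alpha>\<^sup>2 * L\<^sup>2)"
    using \<alpha> by (intro mult_left_mono) auto
  then have "?n * (?g \<bullet> (?y - z))
    \<le> ?n / (2 * \<alpha>) * ((norm (?y - z))\<^sup>2 - (norm (?y - \<alpha> *\<^sub>R ?g - z))\<^sup>2) + ?n * \<alpha> * L\<^sup>2 / 2"
    using \<alpha> by (simp add: distrib_left power2_eq_square)
  with grad show ?thesis by simp
qed

text \<open>The distances to \<open>z\<close> telescope over time, and convexity bounds the value at the time average by the average
  value. Evaluating the total objective at one agent's iterate instead of the average
  costs a third error \<open>L * \<delta>\<close> per summand.\<close>
lemma time_average_suboptimality: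
  fixes X G :: "nat \<Rightarrow> 'a::euclidean_space ^ 'n" and fi :: "'n \<Rightarrow> 'a \<Rightarrow> real"
  assumes conv: "\<And>i. convex_on UNIV (fi i)"
    and bound: "\<And>i z g. g \<in> subdifferential (fi i) z \<Longrightarrow> norm g \<le> L"
    and G: "\<And>i k. G k $ i \<in> subdifferential (fi i) (X k $ i)"
    and step: "\<And>k. avg (X (Suc k)) = avg (X k) - \<alpha> *\<^sub>R avg (G k)"
    and \<alpha>: "0 < \<alpha>" and \<delta>: "\<And>i k. norm (X k $ i - avg (X k)) \<le> \<delta>" and k: "0 < k"
  shows "(\<Sum>j\<in>UNIV. fi j ((1 / real k) *\<^sub>R (\<Sum>h<k. X h $ i)))
    \<le> (\<Sum>j\<in>UNIV. fi j z) + real CARD('n) * (norm (avg (X 0) - z))\<^sup>2 / (2 * \<alpha> * real k)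
      + real CARD('n) * \<alpha> * L\<^sup>2 / 2 + 3 * real CARD('n) * L * \<delta>"
proof -
  let ?n = "real CARD('n)"
  define f where "f w = (\<Sum>j\<in>UNIV. fi j w)" for w
  define P where "P h = (norm (avg (X h) - z))\<^sup>2" for h
  let ?c = "?n * \<alpha> * L\<^sup>2 / 2 + 3 * ?n * L * \<delta>"
  have lip: "fi j a - fi j b \<le> L * norm (a - b)" for j a b
    by (rule subgradient_bound_imp_lipschitz[OF conv bound])
  have L0: "0 \<le> L" using bound[OF G] order_trans[OF norm_ge_zero] by blast
  have iterate: "f (X h $ i) \<le> f (avg (X h)) + ?n * L * \<delta>" for h
  proof -
    have "fi j (X h $ i) \<le> fi j (avg (X h)) + L * \<delta>" for j
      using lip[of j "X h $ i" "avg (X h)"] mult_left_mono[OF \<delta>[of h i] L0] by linarith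
    then have "f (X h $ i) \<le> (\<Sum>j\<in>UNIV. fi j (avg (X h)) + L * \<delta>)"
      unfolding f_def by (rule sum_mono)
    then show ?thesis by (simp add: f_def sum.distrib)
  qed
  have each: "f (X h $ i) - f z \<le> ?n / (2 * \<alpha>) * (P h - P (Suc h)) + ?c" for h
    using averaged_subgradient_step[where X = "X h" and G = "G h" and z = z, OF G bound[OF G] lip \<alpha> \<delta>] iterate[of h]
    by (simp add: f_def P_def step)
  have "(\<Sum>h<k. f (X h $ i)) - real k * f z = (\<Sum>h<k. f (X h $ i) - f z)"
    by (simp add: sum_subtractf)
  also have "\<dots> \<le> (\<Sum>h<k. ?n / (2 * \<alpha>) * (P h - P (Suc h)) + ?c)"
    by (intro sum_mono each)
  also have "\<dots> = ?n / (2 * \<alpha>) * (P 0 - P k) + real k * ?c"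
    by (subst sum.distrib) (simp only: sum_distrib_left[symmetric] sum_lessThan_telescope' sum_constant card_lessThan)
  also have "\<dots> \<le> ?n / (2 * \<alpha>) * P 0 + real k * ?c"
    using \<alpha> by (intro add_right_mono mult_left_mono) (auto simp: P_def)
  finally have total: "(\<Sum>h<k. f (X h $ i)) \<le> real k * f z + ?n / (2 * \<alpha>) * P 0 + real k * ?c" by simp
  have "fi j (\<Sum>h<k. (1 / real k) *\<^sub>R X h $ i) \<le> (\<Sum>h<k. (1 / real k) * fi j (X h $ i))" for j
    using k conv by (intro convex_on_sum[of "{..<k}" UNIV]) auto
  then have "f ((1 / real k) *\<^sub>R (\<Sum>h<k. X h $ i)) \<le> (\<Sum>j\<in>UNIV. \<Sum>h<k. (1 / real k) * fi j (X h $ i))"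
    unfolding f_def scaleR_sum_right by (rule sum_mono)
  also have "\<dots> = (1 / real k) * (\<Sum>h<k. f (X h $ i))"
    unfolding f_def sum_distrib_left by (rule sum.swap)
  also have "\<dots> \<le> (1 / real k) * (real k * f z + ?n / (2 * \<alpha>) * P 0 + real k * ?c)"
    by (intro mult_left_mono total) simp
  also have "\<dots> = f z + ?n * P 0 / (2 * \<alpha> * real k) + ?c"
    using k \<alpha> by (simp add: field_simps)
  finally show ?thesis by (simp add: f_def P_def)
qed

section \<open>The bound with explicit constants\<close>

text \<open>The infimum need not be attained in \<open>S\<close>, so the bound is passed to it as a lower bound
  \<open>sqrt (a / c)\<close> of the distances.\<close>
lemma le_infdist_powerI:
  assumes "S \<noteq> {}" "0 < c" and "\<And>z. z \<in> S \<Longrightarrow> a \<le> c * (dist y z)\<^sup>2"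
  shows "a \<le> c * (infdist y S)\<^sup>2"
proof -
  have "sqrt (a / c) \<le> infdist y S"
    unfolding infdist_notempty[OF assms(1)]
  proof (rule cINF_greatest[OF assms(1)])
    fix z assume "z \<in> S"
    then have "a / c \<le> (dist y z)\<^sup>2" using assms by (simp add: field_simps)
    then show "sqrt (a / c) \<le> dist y z" by (intro real_le_lsqrt) auto
  qed
  then have "a / c \<le> (infdist y S)\<^sup>2" by (rule sqrt_le_D)
  then show ?thesis using assms(2) by (simp add: field_simps)
qed

text \<open>The left-hand side collects the errors of the proof in units of \<open>\<alpha> L\<^sup>2\<close>. Its term \<open>n / 2\<close>
  exceeds the \<open>1 / 2\<close> on the right, and its factor \<open>n\<^sup>2\<close> comes from estimating norms of states by sums
  over agents. Both are absorbed because \<open>B / (1 - \<beta>) \<ge> 4 B\<close>, so that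
  the consensus error is at most \<open>2 B / (1 - \<beta>)\<close>.\<close>
lemma constant_comparison:
  fixes n B \<beta> :: real
  assumes n: "1 \<le> n" and B: "1 \<le> B" and \<beta>: "3 / 4 \<le> \<beta>" "\<beta> < 1"
    and C1: "C1 = 1 + n * B / (\<beta> * (1 - \<beta>))"
  shows "n / 2 + 3 * n\<^sup>2 * (1 + B / (1 - \<beta>) + B) \<le> (1 + 8 * n * C1) / 2 + 2 * n * C1"
proof -
  let ?w = "B / (1 - \<beta>)"
  have "4 * B \<le> ?w" using B \<beta> by (simp add: field_simps)
  then have "1 + ?w + B \<le> 2 * ?w" using B by linarith
  then have "3 * n\<^sup>2 * (1 + ?w + B) \<le> 3 * n\<^sup>2 * (2 * ?w)" by (intro mult_left_mono) auto
  also have "\<dots> = 6 * n * (n * ?w)" by (simp add: power2_eq_square)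
  also have "\<dots> \<le> 6 * n * (C1 - 1)"
  proof (intro mult_left_mono)
    have "n * B / (1 - \<beta>) \<le> n * B / (\<beta> * (1 - \<beta>))"
      using n B \<beta> by (intro divide_left_mono mult_pos_pos) (auto simp: mult_le_cancel_right1)
    then show "n * ?w \<le> C1 - 1" by (simp add: C1)
  qed (use n in simp)
  finally have "3 * n\<^sup>2 * (1 + ?w + B) \<le> 6 * (n * C1) - 6 * n" by (simp add: algebra_simps)
  moreover have "(1 + 8 * n * C1) / 2 + 2 * n * C1 = 1 / 2 + 6 * (n * C1)" by simp
  ultimately show ?thesis using n by linarith
qed

theorem theorem1:
  fixes fi :: "'n::finite \<Rightarrow> real^'m \<Rightarrow> real"
    and f :: "real^'m \<Rightarrow> real"
    and A :: "nat \<Rightarrow> real^'n^'n"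
    and x d :: "'n \<Rightarrow> nat \<Rightarrow> real^'m"
    and xhat :: "'n \<Rightarrow> nat \<Rightarrow> real^'m"
    and y0 :: "real^'m"
    and Xstar :: "(real^'m) set"
    and fstar \<eta> L \<alpha> \<beta> C C1 :: real
    and n B :: nat
  assumes n_eq: "n = CARD('n)"
    and convex: "\<And>i. convex_on UNIV (fi i)"
    and f_eq: "f = (\<lambda>z. \<Sum>i\<in>UNIV. fi i z)"
    and Xstar_eq: "Xstar = {z. is_arg_min f (\<lambda>_. True) z}"
    and Xstar_nonempty: "Xstar \<noteq> {}"
    and fstar_eq: "fstar = (INF z. f z)"
    and weights: "weights_assumption A \<eta>"
    and connectivity: "connectivity_assumption A B"
    and subgradient_bound: "\<And>i z g. g \<in> subdifferential (fi i) z \<Longrightarrow> norm g \<le> L"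
    and alpha_pos: "0 < \<alpha>"
    and d_subgradient: "\<And>i k. d i k \<in> subdifferential (fi i) (x i k)"
    and x_step: "\<And>i k. x i (Suc k) = (\<Sum>j\<in>UNIV. A k $ i $ j *\<^sub>R x j k) - \<alpha> *\<^sub>R d i k"
    and x_init: "(MAX i\<in>UNIV. norm (x i 0)) \<le> \<alpha> * L"
    and xhat_eq: "\<And>i k. 1 \<le> k \<Longrightarrow> xhat i k = (1 / real k) *\<^sub>R (\<Sum>h=0..k-1. x i h)"
    and y0_eq: "y0 = (1 / real n) *\<^sub>R (\<Sum>i\<in>UNIV. x i 0)"
    and beta_eq: "\<beta> = 1 - \<eta> / (4 * (real n)\<^sup>2)"
    and C1_eq: "C1 = 1 + real n * real B / (\<beta> * (1 - \<beta>))"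
    and C_eq: "C = 1 + 8 * real n * C1"
  shows "\<forall>i. \<forall>k\<ge>1. f (xhat i k) \<le>
           fstar + real n * (infdist y0 Xstar)\<^sup>2 / (2 * \<alpha> * real k)
             + \<alpha> * L\<^sup>2 * C / 2 + 2 * \<alpha> * real n * L\<^sup>2 * C1"
proof (intro allI impI)
  fix i :: 'n and k :: nat
  assume k: "1 \<le> k"
  define X where "X h = (\<chi> j. x j h)" for h
  define G where "G h = (\<chi> j. d j h)" for h
  \<comment> \<open>The bound of perturbed_consensus_deviation when both the initial state and each perturbation
    have norm at most n * (alpha * L).\<close>
  define \<delta> where "\<delta> = real n * (\<alpha> * L) * (1 + real B / (1 - \<beta>) + real B)"
  have n: "1 \<le> real n" by (simp add: n_eq Suc_le_eq)
  have B: "1 \<le> real B" using connectivity by (simp add: connectivity_assumption_def)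
  have \<beta>: "3 / 4 \<le> \<beta>" "\<beta> < 1"
    using contraction_factor_ge[OF weights] weights n
    by (simp_all add: beta_eq n_eq weights_assumption_def)
  have mixing: "X (Suc h) = A h ** X h - \<alpha> *\<^sub>R G h" for h
    by (simp add: X_def G_def vec_eq_iff x_step matrix_matrix_mult_def)
  have ds: "doubly_stochastic (A h)" for h using weights by (simp add: weights_assumption_def)
  have norm_le: "norm V \<le> real n * c" if "\<And>j. norm (V $ j) \<le> c" for V :: "real^'m^'n" and c
  proof -
    have "norm V \<le> (\<Sum>j\<in>UNIV. norm (V $ j))"
      unfolding norm_vec_def by (rule L2_set_le_sum) simp
    also have "\<dots> \<le> real n * c" using sum_bounded_above[of UNIV "\<lambda>j. norm (V $ j)" c] that by (simp add: n_eq)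
    finally show ?thesis .
  qed
  have init: "norm (X 0) \<le> real n * (\<alpha> * L)"
  proof (rule norm_le)
    fix j
    have "norm (x j 0) \<le> (MAX i\<in>UNIV. norm (x i 0))" by (rule Max_ge) auto
    then show "norm (X 0 $ j) \<le> \<alpha> * L" using x_init by (simp add: X_def)
  qed
  have noise: "norm (\<alpha> *\<^sub>R G h) \<le> real n * (\<alpha> * L)" for h
    using alpha_pos by (intro norm_le) (simp add: G_def subgradient_bound[OF d_subgradient])
  have consensus: "norm (X h $ j - avg (X h)) \<le> \<delta>" for h j
  proof -
    have "norm (X h $ j - avg (X h)) = norm (deviation (X h) $ j)" by (simp add: deviation_def)
    also have "\<dots> \<le> norm (deviation (X h))" by (rule Finite_Cartesian_Product.norm_nth_le)
    also have "\<dots> \<le> norm (deviation (X 0)) + real B * (real n * (\<alpha> * L)) / (1 - \<beta>)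
        + real B * (real n * (\<alpha> * L))"
      by (rule perturbed_consensus_deviation[OF weights connectivity mixing noise]) (simp add: beta_eq n_eq)
    also have "\<dots> \<le> \<delta>"
      using order_trans[OF norm_deviation_le init] by (simp add: \<delta>_def algebra_simps)
    finally show ?thesis .
  qed
  have avg_step: "avg (X (Suc h)) = avg (X h) - \<alpha> *\<^sub>R avg (G h)" for h
    by (simp add: mixing linear_diff[OF linear_avg] linear_scale[OF linear_avg] avg_mult_matrix[OF ds])
  have xhat: "xhat i k = (1 / real k) *\<^sub>R (\<Sum>h<k. X h $ i)"
  proof -
    have "{0..k - 1} = {..<k}" using k by auto
    then show ?thesis by (simp add: xhat_eq[OF k] X_def)
  qed
  have y0: "y0 = avg (X 0)" by (simp add: y0_eq avg_def X_def n_eq)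
  have minimum: "f z = fstar" if "z \<in> Xstar" for z
  proof -
    have "\<And>w. f z \<le> f w" using that by (auto simp: Xstar_eq is_arg_min_def not_less)
    then show ?thesis unfolding fstar_eq by (intro cInf_eq_minimum[symmetric]) auto
  qed
  have constants: "real n * \<alpha> * L\<^sup>2 / 2 + 3 * real n * L * \<delta>
    \<le> \<alpha> * L\<^sup>2 * C / 2 + 2 * \<alpha> * real n * L\<^sup>2 * C1"
  proof -
    have "real n * \<alpha> * L\<^sup>2 / 2 + 3 * real n * L * \<delta>
      = \<alpha> * L\<^sup>2 * (real n / 2 + 3 * (real n)\<^sup>2 * (1 + real B / (1 - \<beta>) + real B))"
      by (simp add: \<delta>_def power2_eq_square algebra_simps)
    also have "\<dots> \<le> \<alpha> * L\<^sup>2 * ((1 + 8 * real n * C1) / 2 + 2 * real n * C1)"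
      using alpha_pos constant_comparison[OF n B \<beta> C1_eq] by (intro mult_left_mono) auto
    finally show ?thesis by (simp add: C_eq algebra_simps)
  qed
  let ?rest = "fstar + \<alpha> * L\<^sup>2 * C / 2 + 2 * \<alpha> * real n * L\<^sup>2 * C1"
  have "f (xhat i k) - ?rest \<le> real n / (2 * \<alpha> * real k) * (infdist y0 Xstar)\<^sup>2"
  proof (rule le_infdist_powerI[OF Xstar_nonempty])
    show "0 < real n / (2 * \<alpha> * real k)" using n alpha_pos k by simp
    fix z assume z: "z \<in> Xstar"
    have "f (xhat i k) \<le> f z + real n * (norm (y0 - z))\<^sup>2 / (2 * \<alpha> * real k)
        + real n * \<alpha> * L\<^sup>2 / 2 + 3 * real n * L * \<delta>"
      unfolding f_eq xhat y0 n_eq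
    proof (rule time_average_suboptimality[where G = G, OF convex subgradient_bound _ avg_step alpha_pos consensus])
      show "G h $ j \<in> subdifferential (fi j) (X h $ j)" for j h
        by (simp add: G_def X_def d_subgradient)
      show "0 < k" using k by simp
    qed
    then show "f (xhat i k) - ?rest \<le> real n / (2 * \<alpha> * real k) * (dist y0 z)\<^sup>2"
      using constants minimum[OF z] by (simp add: dist_norm)
  qed
  then show "f (xhat i k) \<le> fstar + real n * (infdist y0 Xstar)\<^sup>2 / (2 * \<alpha> * real k)
      + \<alpha> * L\<^sup>2 * C / 2 + 2 * \<alpha> * real n * L\<^sup>2 * C1"
    by simp
qed

end
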